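(* Let $p\geq 5$ be a prime, $H=\langle a,b: a^4=b^2=e,\ a^b=a^{-1}\rangle\cong D_8$, $C=\langle c\rangle$ a cyclic group of order $p$, and $G=H\times C$. Let $\mathcal{S}$ be the partition of $G$ into the sets $$Z_0=\{e\},\ Z_1=\{a^2\},\ Z_2=\{ab\},\ Z_3=\{a^3b\},\ Z_4=\{a,a^3,b,a^2b\},$$ $$X_1=c\{e,a^2\},\ X_2=c\{ab,a^3b\},\ X_3=c\{a,b\},\ X_4=c\{a^3,a^2b\},$$ $$Y_1=c^{-1}\{e,a^2\},\ Y_2=c^{-1}\{ab,a^3b\},\ Y_3=c^{-1}\{a^3,b\},\ Y_4=c^{-1}\{a,a^2b\},$$ $$T_{1k}=c^k\{e,a^2\},\ T_{2k}=c^k\{ab,a^3b\},\ T_{3k}=c^k\{a,a^3,b,a^2b\},\quad k\in\{2,\ldots,p-2\}.$$ Then the $\mathbb{Z}$-module $\mathcal{A}=\mathrm{Span}_{\mathbb{Z}}\{\underline{X}:X\in\mathcal{S}\}$ is an S-ring over $G$.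
   Context: Here $a^b=b^{-1}ab$. For a finite group $G$ with identity $e$ and $X\subseteq G$ put $\underline{X}=\sum_{x\in X}x\in\mathbb{Z}G$ and $X^{-1}=\{x^{-1}:x\in X\}$. A subring $\mathcal{A}\subseteq\mathbb{Z}G$ is an S-ring over $G$ if there is a partition $\mathcal{S}$ of $G$ such that (1) $\{e\}\in\mathcal{S}$; (2) $X\in\mathcal{S}$ implies $X^{-1}\in\mathcal{S}$; (3) $\mathcal{A}=\mathrm{Span}_{\mathbb{Z}}\{\underline{X}:X\in\mathcal{S}\}$. *)

theory Defs
  imports "HOL-Algebra.Algebra" "HOL-Library.Disjoint_Sets" "HOL-Library.Indicator_Function"
    "HOL-Computational_Algebra.Primes"
begin

subsection \<open>Groups given by generators and relations\<close>

text \<open>The letter \<open>(x, True)\<close> stands for the generator \<open>x\<close>, the letter \<open>(x, False)\<close> for its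
  formal inverse.\<close>

type_synonym 'i word = "('i \<times> bool) list"

fun word_eval :: "('g, 'm) monoid_scheme \<Rightarrow> ('i \<Rightarrow> 'g) \<Rightarrow> 'i word \<Rightarrow> 'g" where
  "word_eval G f [] = \<one>\<^bsub>G\<^esub>"
| "word_eval G f ((x, s) # w) = (if s then f x else inv\<^bsub>G\<^esub> (f x)) \<otimes>\<^bsub>G\<^esub> word_eval G f w"

text \<open>A pair \<open>(l, r)\<close> in \<open>R\<close> is the defining relation \<open>l = r\<close>. Two words are related iff they
  represent the same element of the quotient of the free group by the normal closure of the
  elements \<open>l r\<^sup>-\<^sup>1\<close>.\<close>

inductive word_equiv :: "('i word \<times> 'i word) set \<Rightarrow> 'i word \<Rightarrow> 'i word \<Rightarrow> bool"
  for R :: "('i word \<times> 'i word) set" where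
  refl: "word_equiv R w w"
| sym: "word_equiv R u v \<Longrightarrow> word_equiv R v u"
| trans: "word_equiv R u v \<Longrightarrow> word_equiv R v w \<Longrightarrow> word_equiv R u w"
| cancel: "word_equiv R (u @ [(x, s), (x, \<not> s)] @ v) (u @ v)"
| relation: "(l, r) \<in> R \<Longrightarrow> word_equiv R (u @ l @ v) (u @ r @ v)"

text \<open>\<open>G\<close> is presented by the generators \<open>f x\<close> and the relations \<open>R\<close>: the canonical map from
  the abstractly presented group onto \<open>G\<close> is well defined and bijective.\<close>

definition group_presentation ::
  "('g, 'm) monoid_scheme \<Rightarrow> ('i \<Rightarrow> 'g) \<Rightarrow> ('i word \<times> 'i word) set \<Rightarrow> bool" where
  "group_presentation G f R \<longleftrightarrow>
     group G \<and> range f \<subseteq> carrier G \<and> generate G (range f) = carrier G \<and>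
     (\<forall>u v. word_eval G f u = word_eval G f v \<longleftrightarrow> word_equiv R u v)"

datatype D8_gen = Gen_a | Gen_b

definition D8_relations :: "(D8_gen word \<times> D8_gen word) set" where
  "D8_relations =
    {([(Gen_a, True), (Gen_a, True), (Gen_a, True), (Gen_a, True)], []),
     ([(Gen_b, True), (Gen_b, True)], []),
     ([(Gen_b, False), (Gen_a, True), (Gen_b, True)], [(Gen_a, False)])}"

definition D8_presentation :: "('g, 'm) monoid_scheme \<Rightarrow> 'g \<Rightarrow> 'g \<Rightarrow> bool" where
  "D8_presentation H a b \<longleftrightarrow>
     group_presentation H (\<lambda>x. case x of Gen_a \<Rightarrow> a | Gen_b \<Rightarrow> b) D8_relations"


subsection \<open>S-rings over finite groups\<close>

text \<open>The integral group ring of a finite group: an element is its coefficient function, taken to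
  be zero outside the carrier. The element \<open>\<Sum>x\<in>X. x\<close> of the group ring is \<open>indicator X\<close>.\<close>

definition int_group_ring :: "('g, 'm) monoid_scheme \<Rightarrow> ('g \<Rightarrow> int) ring" where
  "int_group_ring G =
    \<lparr>carrier = {f. \<forall>x. x \<notin> carrier G \<longrightarrow> f x = 0},
     monoid.mult = (\<lambda>f g z. \<Sum>(x, y) \<in> {(x, y). x \<in> carrier G \<and> y \<in> carrier G \<and> x \<otimes>\<^bsub>G\<^esub> y = z}.
                      f x * g y),
     monoid.one = indicator {\<one>\<^bsub>G\<^esub>},
     ring.zero = (\<lambda>x. 0),
     ring.add = (\<lambda>f g x. f x + g x)\<rparr>"

definition int_span :: "('g \<Rightarrow> int) set \<Rightarrow> ('g \<Rightarrow> int) set" where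
  "int_span B = {(\<lambda>x. \<Sum>u\<in>F. n u * u x) | F n. finite F \<and> F \<subseteq> B}"

definition partition_span :: "'g set set \<Rightarrow> ('g \<Rightarrow> int) set" where
  "partition_span S = int_span (indicator ` S)"

definition S_ring :: "('g, 'm) monoid_scheme \<Rightarrow> ('g \<Rightarrow> int) set \<Rightarrow> bool" where
  "S_ring G A \<longleftrightarrow>
     group G \<and> finite (carrier G) \<and> subring A (int_group_ring G) \<and>
     (\<exists>S. partition_on (carrier G) S \<and> {\<one>\<^bsub>G\<^esub>} \<in> S \<and>
          (\<forall>Y\<in>S. set_inv\<^bsub>G\<^esub> Y \<in> S) \<and> A = partition_span S)"


subsection \<open>The partition\<close>

definition D8_Cp_partition ::
  "('g, 'm) monoid_scheme \<Rightarrow> 'g \<Rightarrow> 'g \<Rightarrow> 'g \<Rightarrow> nat \<Rightarrow> 'g set set" where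
  "D8_Cp_partition G a b c p =
    (let e = \<one>\<^bsub>G\<^esub>;
         a2 = a [^]\<^bsub>G\<^esub> (2::nat);
         a3 = a [^]\<^bsub>G\<^esub> (3::nat);
         ab = a \<otimes>\<^bsub>G\<^esub> b;
         a2b = a2 \<otimes>\<^bsub>G\<^esub> b;
         a3b = a3 \<otimes>\<^bsub>G\<^esub> b;
         c' = inv\<^bsub>G\<^esub> c
     in {{e}, {a2}, {ab}, {a3b}, {a, a3, b, a2b},
         c <#\<^bsub>G\<^esub> {e, a2}, c <#\<^bsub>G\<^esub> {ab, a3b}, c <#\<^bsub>G\<^esub> {a, b}, c <#\<^bsub>G\<^esub> {a3, a2b},
         c' <#\<^bsub>G\<^esub> {e, a2}, c' <#\<^bsub>G\<^esub> {ab, a3b}, c' <#\<^bsub>G\<^esub> {a3, b}, c' <#\<^bsub>G\<^esub> {a, a2b}}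
        \<union> (\<Union>k\<in>{2..p - 2}.
             {(c [^]\<^bsub>G\<^esub> k) <#\<^bsub>G\<^esub> {e, a2},
              (c [^]\<^bsub>G\<^esub> k) <#\<^bsub>G\<^esub> {ab, a3b},
              (c [^]\<^bsub>G\<^esub> k) <#\<^bsub>G\<^esub> {a, a3, b, a2b}}))"

end

theory Submission
  imports Defs
begin

text \<open>Every class lies in a single layer \<open>H \<times> {y}\<close> with \<open>y \<in> C\<close>, and only four partitions of \<open>H\<close>
  occur as layers: one each for \<open>y = 1\<close>, \<open>y = c\<close>, \<open>y = c\<^sup>-\<^sup>1\<close>, and a common one for all other \<open>y\<close>.
  The span of a partition consists of the functions that are constant on its classes, so closure
  under multiplication says that the convolution of functions adapted to the layers \<open>y\<close> and \<open>z\<close> is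
  adapted to the layer \<open>y z\<close>. Functions adapted to the common layer are adapted to all four, and
  every product of two layers other than \<open>1 \<cdot> y\<close>, \<open>y \<cdot> 1\<close>, \<open>c \<cdot> c\<^sup>-\<^sup>1\<close> and \<open>c\<^sup>-\<^sup>1 \<cdot> c\<close> lands in the
  common one. This leaves finitely many identities between functions on \<open>D\<^sub>8\<close>.\<close>

subsection \<open>Functions constant on the classes of a partition\<close>

definition class_functions :: "'g set \<Rightarrow> 'g set set \<Rightarrow> ('g \<Rightarrow> int) set" where
  "class_functions A P =
    {f. (\<forall>x. x \<notin> A \<longrightarrow> f x = 0) \<and> (\<forall>U\<in>P. \<forall>x\<in>U. \<forall>y\<in>U. f x = f y)}"

lemma class_functionsI:
  assumes "\<And>x. x \<notin> A \<Longrightarrow> f x = 0" "\<And>U x y. \<lbrakk>U \<in> P; x \<in> U; y \<in> U\<rbrakk> \<Longrightarrow> f x = f y"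
  shows "f \<in> class_functions A P"
  using assms unfolding class_functions_def by blast

lemma class_functions_outside: "f \<in> class_functions A P \<Longrightarrow> x \<notin> A \<Longrightarrow> f x = 0"
  unfolding class_functions_def by blast

lemma class_functions_const:
  "f \<in> class_functions A P \<Longrightarrow> U \<in> P \<Longrightarrow> x \<in> U \<Longrightarrow> y \<in> U \<Longrightarrow> f x = f y"
  unfolding class_functions_def by blast

lemma class_functions_sum:
  assumes "\<And>i. i \<in> I \<Longrightarrow> f i \<in> class_functions A P"
  shows "(\<lambda>x. \<Sum>i\<in>I. f i x) \<in> class_functions A P"
proof (rule class_functionsI)
  show "(\<Sum>i\<in>I. f i x) = 0" if "x \<notin> A" for x
    using class_functions_outside[OF assms that] by (simp add: sum.neutral)
  show "(\<Sum>i\<in>I. f i x) = (\<Sum>i\<in>I. f i y)" if "U \<in> P" "x \<in> U" "y \<in> U" for U x y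
    using class_functions_const[OF assms that] by (rule sum.cong[OF HOL.refl])
qed

lemma partition_span_eq_class_functions:
  assumes P: "partition_on A P" and fin: "finite A"
  shows "partition_span P = class_functions A P"
proof
  have finP: "finite P"
    using finite_elements[OF fin P] .
  have sub: "U \<subseteq> A" if "U \<in> P" for U
    using that partition_onD1[OF P] by blast
  have same: "U = Y" if "U \<in> P" "Y \<in> P" "x \<in> U" "x \<in> Y" for U Y x
    using that partition_onD2[OF P] by (auto simp: disjoint_def)
  show "partition_span P \<subseteq> class_functions A P"
  proof
    fix f assume "f \<in> partition_span P"
    then obtain F n where F: "F \<subseteq> indicator ` P" and f: "f = (\<lambda>x. \<Sum>u\<in>F. n u * u x)"
      unfolding partition_span_def int_span_def by blast
    have "(\<lambda>x. n u * u x) \<in> class_functions A P" if u: "u \<in> F" for u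
    proof -
      from u F obtain Y where Y: "Y \<in> P" "u = indicator Y"
        by blast
      show ?thesis
      proof (rule class_functionsI)
        show "n u * u x = 0" if "x \<notin> A" for x
          using that sub Y by (auto simp: indicator_def)
        show "n u * u x = n u * u y" if "U \<in> P" "x \<in> U" "y \<in> U" for U x y
          using that same[of U Y] Y by (auto simp: indicator_def)
      qed
    qed
    then show "f \<in> class_functions A P"
      unfolding f by (rule class_functions_sum)
  qed
  show "class_functions A P \<subseteq> partition_span P"
  proof
    fix f assume f: "f \<in> class_functions A P"
    define n :: "('a \<Rightarrow> int) \<Rightarrow> int" where "n u = f (SOME x. u x = 1)" for u
    have n: "n (indicator U) = f x" if "U \<in> P" "x \<in> U" for U x
    proof -
      have "(SOME y. indicator U y = (1::int)) \<in> U"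
        using that(2) someI[of "\<lambda>y. indicator U y = (1::int)" x] by (auto simp: indicator_def split: if_splits)
      then show ?thesis
        unfolding n_def using class_functions_const[OF f] that by blast
    qed
    have inj: "inj_on (indicator :: 'a set \<Rightarrow> 'a \<Rightarrow> int) P"
      proof (rule inj_onI)
      fix U V :: "'a set" assume "indicator U = (indicator V :: 'a \<Rightarrow> int)"
      then have "indicator U x = (1::int) \<longleftrightarrow> indicator V x = (1::int)" for x
        by simp
      then show "U = V"
        by (auto simp: indicator_eq_1_iff)
    qed
    have "f = (\<lambda>x. \<Sum>u\<in>indicator ` P. n u * u x)"
    proof
      fix x
      have eq: "(\<Sum>u\<in>indicator ` P. n u * u x) = (\<Sum>U\<in>P. n (indicator U) * indicator U x)"
        using inj by (simp add: sum.reindex)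
      show "f x = (\<Sum>u\<in>indicator ` P. n u * u x)"
      proof (cases "x \<in> A")
        case True
        then obtain U where U: "U \<in> P" "x \<in> U"
          using partition_onD1[OF P] by blast
        have "(\<Sum>Y\<in>P. n (indicator Y) * indicator Y x) = (\<Sum>Y\<in>P. if Y = U then f x else 0)"
          using U same n by (intro sum.cong) (auto simp: indicator_def)
        then show ?thesis
          using eq U finP by simp
      next
        case False
        then have "(\<Sum>Y\<in>P. n (indicator Y) * indicator Y x) = 0"
          using sub by (intro sum.neutral) (auto simp: indicator_def)
        then show ?thesis
          using eq False class_functions_outside[OF f] by simp
      qed
    qed
    then show "f \<in> partition_span P"
      unfolding partition_span_def int_span_def using finP by blast
  qed
qed


subsection \<open>Convolution in the integral group ring\<close>

lemma (in group) int_group_ring_mult: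
  assumes "z \<in> carrier G"
  shows "(f \<otimes>\<^bsub>int_group_ring G\<^esub> g) z = (\<Sum>x\<in>carrier G. f x * g (inv x \<otimes> z))"
proof -
  have "(x \<in> carrier G \<and> y \<in> carrier G \<and> x \<otimes> y = z) \<longleftrightarrow> (x \<in> carrier G \<and> y = inv x \<otimes> z)" for x y
    using assms by (metis inv_closed inv_solve_left m_closed)
  then have "{(x, y). x \<in> carrier G \<and> y \<in> carrier G \<and> x \<otimes> y = z} = (\<lambda>x. (x, inv x \<otimes> z)) ` carrier G"
    by auto
  then show ?thesis
    by (simp add: int_group_ring_def sum.reindex inj_on_def)
qed

lemma (in group) int_group_ring_mult_outside:
  assumes "z \<notin> carrier G"
  shows "(f \<otimes>\<^bsub>int_group_ring G\<^esub> g) z = 0"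
proof -
  have "{(x, y). x \<in> carrier G \<and> y \<in> carrier G \<and> x \<otimes> y = z} = {}"
    using assms by auto
  then show ?thesis
    by (simp only: int_group_ring_def monoid.simps sum.empty)
qed

lemma S_ringI:
  assumes G: "group G" and fin: "finite (carrier G)"
    and P: "partition_on (carrier G) S" and one: "{\<one>\<^bsub>G\<^esub>} \<in> S"
    and inv: "\<And>U. U \<in> S \<Longrightarrow> set_inv\<^bsub>G\<^esub> U \<in> S"
    and mult: "\<And>f g. \<lbrakk>f \<in> class_functions (carrier G) S; g \<in> class_functions (carrier G) S\<rbrakk>
      \<Longrightarrow> f \<otimes>\<^bsub>int_group_ring G\<^esub> g \<in> class_functions (carrier G) S"
  shows "S_ring G (partition_span S)"
proof -
  interpret group G by fact
  let ?R = "int_group_ring G" and ?A = "class_functions (carrier G) S"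
  have span: "partition_span S = ?A"
    using partition_span_eq_class_functions[OF P fin] .
  have sub: "?A \<subseteq> carrier ?R"
    by (auto simp: class_functions_def int_group_ring_def)
  have neg: "inv\<^bsub>add_monoid ?R\<^esub> f = (\<lambda>x. - f x)" if "f \<in> carrier ?R" for f
    unfolding m_inv_def
  proof (rule the_equality)
    show "(\<lambda>x. - f x) \<in> carrier (add_monoid ?R) \<and>
      f \<otimes>\<^bsub>add_monoid ?R\<^esub> (\<lambda>x. - f x) = \<one>\<^bsub>add_monoid ?R\<^esub> \<and>
      (\<lambda>x. - f x) \<otimes>\<^bsub>add_monoid ?R\<^esub> f = \<one>\<^bsub>add_monoid ?R\<^esub>"
      using that by (auto simp: int_group_ring_def)
  next
    fix g assume "g \<in> carrier (add_monoid ?R) \<and>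
      f \<otimes>\<^bsub>add_monoid ?R\<^esub> g = \<one>\<^bsub>add_monoid ?R\<^esub> \<and> g \<otimes>\<^bsub>add_monoid ?R\<^esub> f = \<one>\<^bsub>add_monoid ?R\<^esub>"
    then have "\<forall>x. f x + g x = 0"
      by (simp add: int_group_ring_def fun_eq_iff)
    then show "g = (\<lambda>x. - f x)"
      by (simp add: fun_eq_iff eq_neg_iff_add_eq_0 add.commute)
  qed
  have "subgroup ?A (add_monoid ?R)"
  proof
    show "?A \<subseteq> carrier (add_monoid ?R)"
      using sub by simp
    show "f \<otimes>\<^bsub>add_monoid ?R\<^esub> g \<in> ?A" if f: "f \<in> ?A" and g: "g \<in> ?A" for f g
    proof -
      have "(\<lambda>x. f x + g x) \<in> ?A"
      proof (rule class_functionsI)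
        show "f x + g x = 0" if "x \<notin> carrier G" for x
          using f g that by (simp add: class_functions_outside)
        show "f x + g x = f y + g y" if "U \<in> S" "x \<in> U" "y \<in> U" for U x y
          using class_functions_const[OF f that] class_functions_const[OF g that] by simp
      qed
      then show ?thesis
        by (simp add: int_group_ring_def)
    qed
    show "\<one>\<^bsub>add_monoid ?R\<^esub> \<in> ?A"
      by (simp add: int_group_ring_def class_functions_def)
    show "inv\<^bsub>add_monoid ?R\<^esub> f \<in> ?A" if f: "f \<in> ?A" for f
    proof -
      have "(\<lambda>x. - f x) \<in> ?A"
      proof (rule class_functionsI)
        show "- f x = 0" if "x \<notin> carrier G" for x
          using f that by (simp add: class_functions_outside)
        show "- f x = - f y" if "U \<in> S" "x \<in> U" "y \<in> U" for U x y
          using class_functions_const[OF f that] by simp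
      qed
      then show ?thesis
        using neg f sub by auto
    qed
  qed
  moreover have "submonoid ?A ?R"
  proof
    show "?A \<subseteq> carrier ?R"
      by (rule sub)
    show "f \<otimes>\<^bsub>?R\<^esub> g \<in> ?A" if "f \<in> ?A" "g \<in> ?A" for f g
      using mult that .
    have "(indicator {\<one>\<^bsub>G\<^esub>} :: 'a \<Rightarrow> int) \<in> ?A"
    proof (rule class_functionsI)
      fix U x y assume U: "U \<in> S" "x \<in> U" "y \<in> U"
      then have "U = {\<one>\<^bsub>G\<^esub>} \<or> \<one>\<^bsub>G\<^esub> \<notin> U"
        using disjointD[OF partition_onD2[OF P] U(1) one] by auto
      then show "indicator {\<one>\<^bsub>G\<^esub>} x = (indicator {\<one>\<^bsub>G\<^esub>} y :: int)"
        using U by (auto simp: indicator_def)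
    qed (auto simp: indicator_def)
    then show "\<one>\<^bsub>?R\<^esub> \<in> ?A"
      by (simp add: int_group_ring_def)
  qed
  ultimately have "subring ?A ?R"
    by (rule subring.intro)
  then show ?thesis
    unfolding S_ring_def using G fin P one inv span by auto
qed


subsection \<open>Partitions of a direct product given by layers\<close>

definition layered_partition :: "'c set \<Rightarrow> ('c \<Rightarrow> 'h set set) \<Rightarrow> ('h \<times> 'c) set set" where
  "layered_partition C P = (\<Union>y\<in>C. (\<lambda>U. U \<times> {y}) ` P y)"

lemma partition_on_layered:
  fixes H :: "'h set" and C :: "'c set"
  assumes "\<And>y. y \<in> C \<Longrightarrow> partition_on H (P y)"
  shows "partition_on (H \<times> C) (layered_partition C P)"
proof (rule partition_onI)
  show "{} \<notin> layered_partition C P"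
  proof
    assume "{} \<in> layered_partition C P"
    then obtain y U where y: "y \<in> C" and U: "U \<in> P y" "{} = U \<times> {y}"
      unfolding layered_partition_def by blast
    from U(2) have "U = {}"
      by blast
    then show False
      using partition_onD3[OF assms[OF y]] U(1) by simp
  qed
  show "\<Union> (layered_partition C P) = H \<times> C"
  proof (rule Set.set_eqI)
    fix z :: "'h \<times> 'c"
    obtain h y where z: "z = (h, y)"
      by (cases z)
    have "z \<in> \<Union> (layered_partition C P) \<longleftrightarrow> y \<in> C \<and> h \<in> \<Union> (P y)"
      unfolding layered_partition_def z by auto
    also have "\<dots> \<longleftrightarrow> z \<in> H \<times> C"
      using partition_onD1[OF assms[of y]] unfolding z by blast
    finally show "z \<in> \<Union> (layered_partition C P) \<longleftrightarrow> z \<in> H \<times> C" .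
  qed
  show "disjnt U V"
    if U: "U \<in> layered_partition C P" and V: "V \<in> layered_partition C P" and neq: "U \<noteq> V" for U V
  proof -
    from U obtain y U' where y: "y \<in> C" and U': "U' \<in> P y" "U = U' \<times> {y}"
      by (auto simp: layered_partition_def)
    from V obtain z V' where z: "z \<in> C" and V': "V' \<in> P z" "V = V' \<times> {z}"
      by (auto simp: layered_partition_def)
    show ?thesis
    proof (cases "y = z")
      case True
      then have "U' \<inter> V' = {}"
        using U' V' neq partition_onD2[OF assms[OF y]] by (auto simp: disjoint_def)
      then show ?thesis
        using U' V' by (auto simp: disjnt_def)
    next
      case False
      then show ?thesis
        using U' V' by (auto simp: disjnt_def)
    qed
  qed
qed

lemma class_functions_layered:
  "f \<in> class_functions (H \<times> C) (layered_partition C P) \<longleftrightarrow>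
    (\<forall>z. z \<notin> H \<times> C \<longrightarrow> f z = 0) \<and> (\<forall>y\<in>C. (\<lambda>x. f (x, y)) \<in> class_functions H (P y))"
proof -
  have "(\<forall>z. z \<notin> H \<times> C \<longrightarrow> f z = 0) \<longrightarrow> (\<forall>y\<in>C. \<forall>x. x \<notin> H \<longrightarrow> f (x, y) = 0)"
    by simp
  moreover have "(\<forall>W\<in>layered_partition C P. \<forall>z\<in>W. \<forall>w\<in>W. f z = f w) \<longleftrightarrow>
      (\<forall>y\<in>C. \<forall>U\<in>P y. \<forall>x\<in>U. \<forall>x'\<in>U. f (x, y) = f (x', y))"
    by (simp add: layered_partition_def)
  ultimately show ?thesis
    unfolding class_functions_def mem_Collect_eq ball_conj_distrib by satx
qed

lemma S_ring_layered:
  assumes "group H" "finite (carrier H)" "group C" "finite (carrier C)"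
    and P: "\<And>y. y \<in> carrier C \<Longrightarrow> partition_on (carrier H) (P y)"
    and one: "{\<one>\<^bsub>H\<^esub>} \<in> P \<one>\<^bsub>C\<^esub>"
    and inv: "\<And>y U. \<lbrakk>y \<in> carrier C; U \<in> P y\<rbrakk> \<Longrightarrow> set_inv\<^bsub>H\<^esub> U \<in> P (inv\<^bsub>C\<^esub> y)"
    and mult: "\<And>y z f g. \<lbrakk>y \<in> carrier C; z \<in> carrier C;
        f \<in> class_functions (carrier H) (P y); g \<in> class_functions (carrier H) (P z)\<rbrakk>
      \<Longrightarrow> f \<otimes>\<^bsub>int_group_ring H\<^esub> g \<in> class_functions (carrier H) (P (y \<otimes>\<^bsub>C\<^esub> z))"
  shows "S_ring (H \<times>\<times> C) (partition_span (layered_partition (carrier C) P))"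
proof -
  interpret H: group H by fact
  interpret C: group C by fact
  let ?G = "H \<times>\<times> C" and ?S = "layered_partition (carrier C) P"
  interpret G: group ?G
    by (rule DirProd_group) fact+
  have G: "carrier ?G = carrier H \<times> carrier C"
    by (simp add: DirProd_def)
  show ?thesis
  proof (rule S_ringI)
    show "group ?G" ..
    show "finite (carrier ?G)"
      using assms(2,4) by (simp add: G)
    show "partition_on (carrier ?G) ?S"
      unfolding G using P by (rule partition_on_layered)
    show "{\<one>\<^bsub>?G\<^esub>} \<in> ?S"
      unfolding layered_partition_def one_DirProd using one
      by (intro UN_I[OF C.one_closed] image_eqI[where x = "{\<one>\<^bsub>H\<^esub>}"]) auto
    show "set_inv\<^bsub>?G\<^esub> Y \<in> ?S" if "Y \<in> ?S" for Y
    proof -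
      from that obtain y U where y: "y \<in> carrier C" and U: "U \<in> P y" and Y: "Y = U \<times> {y}"
        by (auto simp: layered_partition_def)
      have "U \<subseteq> carrier H"
        using partition_onD1[OF P[OF y]] U by blast
      then have "set_inv\<^bsub>?G\<^esub> Y = (set_inv\<^bsub>H\<^esub> U) \<times> {inv\<^bsub>C\<^esub> y}"
        using y assms(1,3) by (auto simp: Y SET_INV_def subset_iff)
      then show ?thesis
        using inv[OF y U] y by (auto simp: layered_partition_def)
    qed
    fix f g
    assume "f \<in> class_functions (carrier ?G) ?S" and "g \<in> class_functions (carrier ?G) ?S"
    then have f: "\<And>y. y \<in> carrier C \<Longrightarrow> (\<lambda>x. f (x, y)) \<in> class_functions (carrier H) (P y)"
      and g: "\<And>y. y \<in> carrier C \<Longrightarrow> (\<lambda>x. g (x, y)) \<in> class_functions (carrier H) (P y)"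
      unfolding G class_functions_layered by blast+
    have "(\<lambda>x. (f \<otimes>\<^bsub>int_group_ring ?G\<^esub> g) (x, z)) \<in> class_functions (carrier H) (P z)"
      if z: "z \<in> carrier C" for z
    proof -
      have eq: "(\<lambda>x. (f \<otimes>\<^bsub>int_group_ring ?G\<^esub> g) (x, z)) =
        (\<lambda>x. \<Sum>y\<in>carrier C. ((\<lambda>x. f (x, y)) \<otimes>\<^bsub>int_group_ring H\<^esub> (\<lambda>x. g (x, inv\<^bsub>C\<^esub> y \<otimes>\<^bsub>C\<^esub> z))) x)"
      proof
        fix x
        show "(f \<otimes>\<^bsub>int_group_ring ?G\<^esub> g) (x, z) = (\<Sum>y\<in>carrier C.
          ((\<lambda>x. f (x, y)) \<otimes>\<^bsub>int_group_ring H\<^esub> (\<lambda>x. g (x, inv\<^bsub>C\<^esub> y \<otimes>\<^bsub>C\<^esub> z))) x)"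
        proof (cases "x \<in> carrier H")
          case True
          then have "(f \<otimes>\<^bsub>int_group_ring ?G\<^esub> g) (x, z) = (\<Sum>(u, y)\<in>carrier H \<times> carrier C.
              f (u, y) * g (inv\<^bsub>H\<^esub> u \<otimes>\<^bsub>H\<^esub> x, inv\<^bsub>C\<^esub> y \<otimes>\<^bsub>C\<^esub> z))"
            using z assms(1,3)
            by (subst G.int_group_ring_mult) (auto simp: G intro!: sum.cong)
          also have "\<dots> = (\<Sum>y\<in>carrier C. \<Sum>u\<in>carrier H.
              f (u, y) * g (inv\<^bsub>H\<^esub> u \<otimes>\<^bsub>H\<^esub> x, inv\<^bsub>C\<^esub> y \<otimes>\<^bsub>C\<^esub> z))"
            by (subst sum.cartesian_product[symmetric]) (rule sum.swap)
          finally show ?thesis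
            using True by (simp add: H.int_group_ring_mult)
        next
          case False
          then show ?thesis
            by (simp add: H.int_group_ring_mult_outside G.int_group_ring_mult_outside G)
        qed
      qed
      show ?thesis
        unfolding eq
      proof (rule class_functions_sum)
        fix y assume y: "y \<in> carrier C"
        then have "y \<otimes>\<^bsub>C\<^esub> (inv\<^bsub>C\<^esub> y \<otimes>\<^bsub>C\<^esub> z) = z"
          using z by (simp add: C.m_assoc[symmetric])
        then show "(\<lambda>x. f (x, y)) \<otimes>\<^bsub>int_group_ring H\<^esub> (\<lambda>x. g (x, inv\<^bsub>C\<^esub> y \<otimes>\<^bsub>C\<^esub> z))
            \<in> class_functions (carrier H) (P z)"
          using mult[OF y _ f[OF y] g, of "inv\<^bsub>C\<^esub> y \<otimes>\<^bsub>C\<^esub> z"] y z by simp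
      qed
    qed
    then show "f \<otimes>\<^bsub>int_group_ring ?G\<^esub> g \<in> class_functions (carrier ?G) ?S"
      unfolding G class_functions_layered
      using G.int_group_ring_mult_outside by (simp add: G)
  qed
qed


subsection \<open>The dihedral group of order 8\<close>

fun square_act_letter :: "D8_gen \<times> bool \<Rightarrow> int \<Rightarrow> int" where
  "square_act_letter (Gen_a, s) x = (if s then x + 1 else x - 1)"
| "square_act_letter (Gen_b, s) x = - x"

text \<open>Modulo 4 this is the action on the vertices of a square; it detects that the eight normal
  forms \<open>a\<^sup>i b\<^sup>j\<close> are distinct.\<close>

definition square_act :: "D8_gen word \<Rightarrow> int \<Rightarrow> int" where
  "square_act w x = foldr square_act_letter w x"

lemma square_act_simps [simp]:
  "square_act [] x = x"
  "square_act (l # w) x = square_act_letter l (square_act w x)"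
  "square_act (u @ v) x = square_act u (square_act v x)"
  by (simp_all add: square_act_def)

lemma square_act_dvd:
  "4 dvd x - y \<Longrightarrow> 4 dvd square_act w x - square_act w y"
proof (induction w)
  case (Cons l w)
  then show ?case
    by (cases l rule: prod.exhaust; cases "fst l") (auto simp: dvd_diff_commute)
qed simp

lemma word_equiv_square_act:
  "word_equiv D8_relations u v \<Longrightarrow> 4 dvd square_act u x - square_act v x"
proof (induction arbitrary: x rule: word_equiv.induct)
  case (sym u v)
  then show ?case
    by (metis dvd_diff_commute)
next
  case (trans u v w)
  then show ?case
    using dvd_add[OF trans.IH(1)[of x] trans.IH(2)[of x]] by simp
next
  case (cancel u y s v)
  then show ?case
    by (cases y) (auto intro: square_act_dvd)
next
  case (relation l r u v)
  then show ?case
    by (auto simp: D8_relations_def intro!: square_act_dvd)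
qed simp

locale dihedral8 =
  fixes H (structure) and a b
  assumes presentation: "D8_presentation H a b"
begin

definition d :: "nat \<Rightarrow> nat \<Rightarrow> 'a" where
  "d i j = a [^] i \<otimes> b [^] j"

abbreviation gens :: "D8_gen \<Rightarrow> 'a" where
  "gens x \<equiv> (case x of Gen_a \<Rightarrow> a | Gen_b \<Rightarrow> b)"

lemma is_group: "group H"
  using presentation by (simp add: D8_presentation_def group_presentation_def)

sublocale group H
  by (rule is_group)

lemma range_gens: "range gens = {a, b}"
  by (auto simp: image_iff split: D8_gen.splits)

lemma generators_closed [simp, intro]: "a \<in> carrier H" "b \<in> carrier H"
  and generate_generators: "generate H {a, b} = carrier H"
  using presentation unfolding D8_presentation_def group_presentation_def range_gens by auto

lemma word_eval_eq_iff: "word_eval H gens u = word_eval H gens v \<longleftrightarrow> word_equiv D8_relations u v"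
  using presentation by (simp add: D8_presentation_def group_presentation_def)

lemma word_eval_relation: "(l, r) \<in> D8_relations \<Longrightarrow> word_eval H gens l = word_eval H gens r"
  unfolding word_eval_eq_iff using word_equiv.relation[of l r D8_relations "[]" "[]"] by simp

lemma a_pow_4: "a [^] (4::nat) = \<one>"
  using word_eval_relation[of "[(Gen_a, True), (Gen_a, True), (Gen_a, True), (Gen_a, True)]" "[]"]
  by (simp add: D8_relations_def numeral_eq_Suc m_assoc)

lemma b_square: "b \<otimes> b = \<one>"
  using word_eval_relation[of "[(Gen_b, True), (Gen_b, True)]" "[]"] by (simp add: D8_relations_def)

lemma b_a: "b \<otimes> a = a [^] (3::nat) \<otimes> b"
proof -
  have "inv b \<otimes> (a \<otimes> b) = inv a"
    using word_eval_relation[of "[(Gen_b, False), (Gen_a, True), (Gen_b, True)]" "[(Gen_a, False)]"]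
    by (simp add: D8_relations_def)
  moreover have "inv b = b"
    using b_square by (simp add: inv_equality)
  moreover have "inv a = a [^] (3::nat)"
    using a_pow_4 by (intro inv_equality) (simp_all add: numeral_eq_Suc m_assoc)
  ultimately have "b \<otimes> (a \<otimes> b) \<otimes> b = a [^] (3::nat) \<otimes> b"
    by simp
  then show ?thesis
    by (simp add: m_assoc b_square)
qed

lemma b_a_pow: "b \<otimes> a [^] (k::nat) = a [^] (3 * k) \<otimes> b"
proof (induction k)
  case (Suc k)
  have "b \<otimes> a [^] Suc k = (b \<otimes> a [^] k) \<otimes> a"
    by (simp add: m_assoc)
  also have "\<dots> = a [^] (3 * k) \<otimes> (b \<otimes> a)"
    by (simp add: Suc.IH m_assoc)
  also have "\<dots> = (a [^] (3 * k) \<otimes> a [^] (3::nat)) \<otimes> b"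
    by (simp add: b_a m_assoc)
  finally show ?case
    by (simp add: nat_pow_mult add.commute)
qed simp

lemma b_pow_a_pow: "b [^] (j::nat) \<otimes> a [^] (k::nat) = a [^] (3 ^ j * k) \<otimes> b [^] j"
proof (induction j arbitrary: k)
  case (Suc j)
  have "b [^] Suc j \<otimes> a [^] k = b [^] j \<otimes> (b \<otimes> a [^] k)"
    by (simp add: m_assoc)
  also have "\<dots> = (b [^] j \<otimes> a [^] (3 * k)) \<otimes> b"
    by (simp add: b_a_pow m_assoc)
  also have "\<dots> = a [^] (3 ^ Suc j * k) \<otimes> b [^] Suc j"
    by (simp add: Suc.IH m_assoc ac_simps)
  finally show ?case .
qed simp

lemma a_pow_mod: "a [^] (i mod 4) = a [^] (i::nat)"
proof -
  have "a [^] i = (a [^] (4::nat)) [^] (i div 4) \<otimes> a [^] (i mod 4)"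
    by (simp add: nat_pow_pow nat_pow_mult)
  then show ?thesis
    by (simp add: a_pow_4)
qed

lemma b_pow_mod: "b [^] (j mod 2) = b [^] (j::nat)"
proof -
  have "b [^] j = (b [^] (2::nat)) [^] (j div 2) \<otimes> b [^] (j mod 2)"
    by (simp add: nat_pow_pow nat_pow_mult)
  then show ?thesis
    using b_square by (simp add: numeral_eq_Suc)
qed

lemma d_closed [simp, intro]: "d i j \<in> carrier H"
  by (simp add: d_def)

lemma d_mod: "d (i mod 4) (j mod 2) = d i j"
  by (simp add: d_def a_pow_mod b_pow_mod)

lemma d_mult: "d i j \<otimes> d k l = d ((i + 3 ^ j * k) mod 4) ((j + l) mod 2)"
proof -
  have "d i j \<otimes> d k l = a [^] i \<otimes> (b [^] j \<otimes> a [^] k) \<otimes> b [^] l"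
    by (simp add: d_def m_assoc)
  also have "\<dots> = (a [^] i \<otimes> a [^] (3 ^ j * k)) \<otimes> (b [^] j \<otimes> b [^] l)"
    by (simp add: b_pow_a_pow m_assoc)
  also have "\<dots> = d (i + 3 ^ j * k) (j + l)"
    by (simp add: d_def nat_pow_mult)
  finally show ?thesis
    by (simp only: d_mod)
qed

lemma d_eq_iff [simp]: "d i j = d k l \<longleftrightarrow> i mod 4 = k mod 4 \<and> j mod 2 = l mod 2"
proof
  define w where "w i j = replicate i (Gen_a, True) @ replicate j (Gen_b, True)" for i j :: nat
  have a: "word_eval H gens (replicate i (Gen_a, True) @ v) = a [^] i \<otimes> word_eval H gens v"
    if "word_eval H gens v \<in> carrier H" for i v
  proof (induction i)
    case (Suc i)
    then show ?case
      using that by (subst nat_pow_Suc2) (simp_all add: m_assoc)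
  qed (simp add: that)
  have b: "word_eval H gens (replicate j (Gen_b, True)) = b [^] j" for j
  proof (induction j)
    case (Suc j)
    then show ?case
      by (subst nat_pow_Suc2) simp_all
  qed simp
  have w: "word_eval H gens (w i j) = d i j" for i j
    by (simp add: w_def a b d_def)
  have act_a: "square_act (replicate i (Gen_a, True)) x = x + int i" for i x
    by (induction i) auto
  have act_b: "square_act (replicate j (Gen_b, True)) x = (if even j then x else - x)" for j x
    by (induction j) auto
  assume "d i j = d k l"
  then have "word_equiv D8_relations (w i j) (w k l)"
    by (simp add: word_eval_eq_iff[symmetric] w)
  then have act: "4 dvd square_act (w i j) x - square_act (w k l) x" for x
    by (rule word_equiv_square_act)
  show "i mod 4 = k mod 4 \<and> j mod 2 = l mod 2"
    using act[of 0] act[of 1] by (simp add: w_def act_a act_b split: if_splits) presburger+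
next
  assume "i mod 4 = k mod 4 \<and> j mod 2 = l mod 2"
  then show "d i j = d k l"
    by (metis d_mod)
qed

lemma one_eq_d: "\<one> = d 0 0"
  by (simp add: d_def)

lemma inv_d:
  "inv (d 0 0) = d 0 0" "inv (d (Suc 0) 0) = d 3 0" "inv (d 2 0) = d 2 0" "inv (d 3 0) = d (Suc 0) 0"
  "inv (d i (Suc 0)) = d i (Suc 0)"
  by (intro inv_equality; simp add: d_mult one_eq_d)+

lemma carrier_eq_d: "carrier H = {d 0 0, d 1 0, d 2 0, d 3 0, d 0 1, d 1 1, d 2 1, d 3 1}"
  (is "_ = ?D")
proof
  have D: "d i j \<in> ?D" for i j
  proof -
    have "i mod 4 \<in> {0, 1, 2, 3}" "j mod 2 \<in> {0, 1}"
      by auto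
    then have "d (i mod 4) (j mod 2) \<in> ?D"
      by (auto simp del: d_eq_iff)
    then show ?thesis
      by (simp only: d_mod)
  qed
  have gen: "a = d 1 0" "b = d 0 1"
    by (simp_all add: d_def)
  have "\<exists>i j. x = d i j" if "x \<in> generate H {a, b}" for x
    using that
  proof induction
    case one
    then show ?case
      using one_eq_d by blast
  next
    case (incl h)
    then show ?case
      using gen by blast
  next
    case (inv h)
    have "inv a = d 3 0" "inv b = d 0 1"
      using inv_d(2) inv_d(5)[of 0] by (simp_all only: gen[symmetric] One_nat_def[symmetric])
    then show ?case
      using inv by blast
  next
    case (eng h1 h2)
    then show ?case
      using d_mult by blast
  qed
  then show "carrier H \<subseteq> ?D"
    using D generate_generators by blast
qed auto

lemma finite_carrier: "finite (carrier H)"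
  by (simp add: carrier_eq_d)

lemma sum_carrier:
  fixes f :: "'a \<Rightarrow> int"
  shows "(\<Sum>x\<in>carrier H. f x) = f (d 0 0) + f (d (Suc 0) 0) + f (d 2 0) + f (d 3 0) +
    f (d 0 (Suc 0)) + f (d (Suc 0) (Suc 0)) + f (d 2 (Suc 0)) + f (d 3 (Suc 0))"
  by (simp add: carrier_eq_d)

definition layer_one :: "'a set set" where
  "layer_one = {{d 0 0}, {d 2 0}, {d 1 1}, {d 3 1}, {d 1 0, d 3 0, d 0 1, d 2 1}}"

definition layer_c :: "'a set set" where
  "layer_c = {{d 0 0, d 2 0}, {d 1 1, d 3 1}, {d 1 0, d 0 1}, {d 3 0, d 2 1}}"

definition layer_inv_c :: "'a set set" where
  "layer_inv_c = {{d 0 0, d 2 0}, {d 1 1, d 3 1}, {d 3 0, d 0 1}, {d 1 0, d 2 1}}"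

definition layer_rest :: "'a set set" where
  "layer_rest = {{d 0 0, d 2 0}, {d 1 1, d 3 1}, {d 1 0, d 3 0, d 0 1, d 2 1}}"

lemmas layer_defs = layer_one_def layer_c_def layer_inv_c_def layer_rest_def

lemma partition_on_layers:
  "partition_on (carrier H) layer_one"
  "partition_on (carrier H) layer_c"
  "partition_on (carrier H) layer_inv_c"
  "partition_on (carrier H) layer_rest"
  by (rule partition_onI; auto simp: layer_defs carrier_eq_d disjnt_def)+

lemma set_inv_layers:
  "U \<in> layer_one \<Longrightarrow> set_inv U \<in> layer_one"
  "U \<in> layer_c \<Longrightarrow> set_inv U \<in> layer_inv_c"
  "U \<in> layer_inv_c \<Longrightarrow> set_inv U \<in> layer_c"
  "U \<in> layer_rest \<Longrightarrow> set_inv U \<in> layer_rest"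
proof -
  have set_inv: "set_inv U = m_inv H ` U" for U
    by (auto simp: SET_INV_def)
  show "U \<in> layer_one \<Longrightarrow> set_inv U \<in> layer_one"
    "U \<in> layer_c \<Longrightarrow> set_inv U \<in> layer_inv_c"
    "U \<in> layer_inv_c \<Longrightarrow> set_inv U \<in> layer_c"
    "U \<in> layer_rest \<Longrightarrow> set_inv U \<in> layer_rest"
    unfolding layer_defs set_inv by (elim insertE emptyE; simp add: inv_d insert_commute)+
qed

abbreviation class_fns :: "'a set set \<Rightarrow> ('a \<Rightarrow> int) set" where
  "class_fns \<equiv> class_functions (carrier H)"

lemma class_fns_iff:
  "f \<in> class_fns layer_one \<longleftrightarrow> (\<forall>x. x \<notin> carrier H \<longrightarrow> f x = 0) \<and>
    f (d (Suc 0) 0) = f (d 2 (Suc 0)) \<and> f (d 3 0) = f (d 2 (Suc 0)) \<and> f (d 0 (Suc 0)) = f (d 2 (Suc 0))"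
  "f \<in> class_fns layer_c \<longleftrightarrow> (\<forall>x. x \<notin> carrier H \<longrightarrow> f x = 0) \<and>
    f (d 0 0) = f (d 2 0) \<and> f (d (Suc 0) (Suc 0)) = f (d 3 (Suc 0)) \<and>
    f (d (Suc 0) 0) = f (d 0 (Suc 0)) \<and> f (d 3 0) = f (d 2 (Suc 0))"
  "f \<in> class_fns layer_inv_c \<longleftrightarrow> (\<forall>x. x \<notin> carrier H \<longrightarrow> f x = 0) \<and>
    f (d 0 0) = f (d 2 0) \<and> f (d (Suc 0) (Suc 0)) = f (d 3 (Suc 0)) \<and>
    f (d 3 0) = f (d 0 (Suc 0)) \<and> f (d (Suc 0) 0) = f (d 2 (Suc 0))"
  "f \<in> class_fns layer_rest \<longleftrightarrow> (\<forall>x. x \<notin> carrier H \<longrightarrow> f x = 0) \<and>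
    f (d 0 0) = f (d 2 0) \<and> f (d (Suc 0) (Suc 0)) = f (d 3 (Suc 0)) \<and>
    f (d (Suc 0) 0) = f (d 2 (Suc 0)) \<and> f (d 3 0) = f (d 2 (Suc 0)) \<and> f (d 0 (Suc 0)) = f (d 2 (Suc 0))"
  unfolding class_functions_def layer_defs by (simp; metis)+

lemma class_fns_rest_subset:
  "class_fns layer_rest \<subseteq> class_fns layer_one"
  "class_fns layer_rest \<subseteq> class_fns layer_c"
  "class_fns layer_rest \<subseteq> class_fns layer_inv_c"
  by (simp_all add: subset_iff class_fns_iff)

lemma conv_d:
  "(f \<otimes>\<^bsub>int_group_ring H\<^esub> g) (d k l) = (\<Sum>x\<in>carrier H. f x * g (inv x \<otimes> d k l))"
  by (rule int_group_ring_mult) simp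

lemma class_fns_mult:
  fixes f g :: "'a \<Rightarrow> int"
  defines "h \<equiv> f \<otimes>\<^bsub>int_group_ring H\<^esub> g"
  shows "f \<in> class_fns layer_one \<Longrightarrow> g \<in> class_fns layer_one \<Longrightarrow> h \<in> class_fns layer_one"
    "f \<in> class_fns layer_one \<Longrightarrow> g \<in> class_fns layer_c \<Longrightarrow> h \<in> class_fns layer_c"
    "f \<in> class_fns layer_one \<Longrightarrow> g \<in> class_fns layer_inv_c \<Longrightarrow> h \<in> class_fns layer_inv_c"
    "f \<in> class_fns layer_one \<Longrightarrow> g \<in> class_fns layer_rest \<Longrightarrow> h \<in> class_fns layer_rest"
    "f \<in> class_fns layer_c \<Longrightarrow> g \<in> class_fns layer_one \<Longrightarrow> h \<in> class_fns layer_c"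
    "f \<in> class_fns layer_c \<Longrightarrow> g \<in> class_fns layer_c \<Longrightarrow> h \<in> class_fns layer_rest"
    "f \<in> class_fns layer_c \<Longrightarrow> g \<in> class_fns layer_inv_c \<Longrightarrow> h \<in> class_fns layer_one"
    "f \<in> class_fns layer_c \<Longrightarrow> g \<in> class_fns layer_rest \<Longrightarrow> h \<in> class_fns layer_rest"
    "f \<in> class_fns layer_inv_c \<Longrightarrow> g \<in> class_fns layer_one \<Longrightarrow> h \<in> class_fns layer_inv_c"
    "f \<in> class_fns layer_inv_c \<Longrightarrow> g \<in> class_fns layer_c \<Longrightarrow> h \<in> class_fns layer_one"
    "f \<in> class_fns layer_inv_c \<Longrightarrow> g \<in> class_fns layer_inv_c \<Longrightarrow> h \<in> class_fns layer_rest"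
    "f \<in> class_fns layer_inv_c \<Longrightarrow> g \<in> class_fns layer_rest \<Longrightarrow> h \<in> class_fns layer_rest"
    "f \<in> class_fns layer_rest \<Longrightarrow> g \<in> class_fns layer_one \<Longrightarrow> h \<in> class_fns layer_rest"
    "f \<in> class_fns layer_rest \<Longrightarrow> g \<in> class_fns layer_c \<Longrightarrow> h \<in> class_fns layer_rest"
    "f \<in> class_fns layer_rest \<Longrightarrow> g \<in> class_fns layer_inv_c \<Longrightarrow> h \<in> class_fns layer_rest"
    "f \<in> class_fns layer_rest \<Longrightarrow> g \<in> class_fns layer_rest \<Longrightarrow> h \<in> class_fns layer_rest"
  unfolding h_def class_fns_iff
  by (simp_all add: int_group_ring_mult_outside conv_d sum_carrier inv_d d_mult algebra_simps
      numeral_2_eq_2[symmetric] numeral_3_eq_3[symmetric])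

end

subsection \<open>The product with a cyclic group\<close>

lemma pow_DirProd: "(x, y) [^]\<^bsub>G \<times>\<times> H\<^esub> (n::nat) = (x [^]\<^bsub>G\<^esub> n, y [^]\<^bsub>H\<^esub> n)"
  by (induction n) (simp_all add: nat_pow_def DirProd_def)

theorem lemma3p2:
  fixes p :: nat
    and H :: "('h, 'm) monoid_scheme" and a b :: 'h
    and C :: "('c, 'n) monoid_scheme" and c :: 'c
    and G :: "('h \<times> 'c) monoid" and S :: "('h \<times> 'c) set set"
  assumes "Factorial_Ring.prime p" and "p \<ge> 5"
    and "D8_presentation H a b"
    and "group C" and "c \<in> carrier C" and "carrier C = generate C {c}" and "order C = p"
    and "G = H \<times>\<times> C"
    and "S = D8_Cp_partition G (a, \<one>\<^bsub>C\<^esub>) (b, \<one>\<^bsub>C\<^esub>) (\<one>\<^bsub>H\<^esub>, c) p"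
  shows "partition_on (carrier G) S \<and> S_ring G (partition_span S)"
proof -
  interpret D: dihedral8 H a b
    by unfold_locales fact
  interpret C: group C
    by fact
  note c = \<open>c \<in> carrier C\<close> and p = \<open>p \<ge> 5\<close>
  have ord: "C.ord c = p"
    using C.generate_pow_card[OF c] assms(6,7) by (simp add: order_def)
  have finite_C: "finite (carrier C)"
    using assms(7) p by (intro card_ge_0_finite) (simp add: order_def)
  have pow_eq: "c [^]\<^bsub>C\<^esub> i = c [^]\<^bsub>C\<^esub> j \<longleftrightarrow> i = j" if "i < p" "j < p" for i j :: nat
    using C.ord_inj[OF c] that p by (fastforce simp: ord inj_on_def)
  have "(\<lambda>k. c [^]\<^bsub>C\<^esub> k) ` {..<p} = carrier C"
  proof (rule card_subset_eq[OF finite_C])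
    show "(\<lambda>k. c [^]\<^bsub>C\<^esub> k) ` {..<p} \<subseteq> carrier C"
      using c by auto
    have "inj_on (\<lambda>k. c [^]\<^bsub>C\<^esub> k) {..<p}"
      using pow_eq by (auto simp: inj_on_def)
    then show "card ((\<lambda>k. c [^]\<^bsub>C\<^esub> k) ` {..<p}) = card (carrier C)"
      using assms(7) by (simp add: card_image order_def)
  qed
  moreover have "{..<p} = {0, 1, p - 1} \<union> {2..p - 2}"
    using p by auto
  moreover have inv_c: "inv\<^bsub>C\<^esub> c = c [^]\<^bsub>C\<^esub> (p - 1)"
  proof (rule C.inv_equality)
    show "c [^]\<^bsub>C\<^esub> (p - 1) \<otimes>\<^bsub>C\<^esub> c = \<one>\<^bsub>C\<^esub>"
      using C.pow_ord_eq_1[OF c] p by (simp add: ord C.nat_pow_Suc[symmetric] del: C.nat_pow_Suc)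
  qed (use c in auto)
  ultimately have carrier_C: "carrier C = {\<one>\<^bsub>C\<^esub>, c, inv\<^bsub>C\<^esub> c} \<union> (\<lambda>k. c [^]\<^bsub>C\<^esub> k) ` {2..p - 2}"
    using c by (auto simp: image_Un)
  have distinct: "c \<noteq> \<one>\<^bsub>C\<^esub>" "inv\<^bsub>C\<^esub> c \<noteq> \<one>\<^bsub>C\<^esub>" "inv\<^bsub>C\<^esub> c \<noteq> c"
    using pow_eq[of 1 0] pow_eq[of "p - 1" 0] pow_eq[of "p - 1" 1] p c by (auto simp: inv_c)
  have distinct_pow: "c [^]\<^bsub>C\<^esub> k \<notin> {\<one>\<^bsub>C\<^esub>, c, inv\<^bsub>C\<^esub> c}" if "k \<in> {2..p - 2}" for k
  proof -
    have "k < p" "k \<noteq> 0" "k \<noteq> 1" "k \<noteq> p - 1"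
      using that p by auto
    then show ?thesis
      using pow_eq[of k 0] pow_eq[of k 1] pow_eq[of k "p - 1"] c by (simp add: inv_c)
  qed

  define P where "P y = (if y = \<one>\<^bsub>C\<^esub> then D.layer_one else if y = c then D.layer_c
    else if y = inv\<^bsub>C\<^esub> c then D.layer_inv_c else D.layer_rest)" for y
  have P: "P \<one>\<^bsub>C\<^esub> = D.layer_one" "P c = D.layer_c" "P (inv\<^bsub>C\<^esub> c) = D.layer_inv_c"
    using distinct by (simp_all add: P_def)
  have P_rest: "P y = D.layer_rest" if "y \<notin> {\<one>\<^bsub>C\<^esub>, c, inv\<^bsub>C\<^esub> c}" for y
    using that by (simp add: P_def)
  have partition: "partition_on (carrier H) (P y)" for y
    using D.partition_on_layers by (simp add: P_def)

  have "layered_partition (carrier C) P =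
    (\<lambda>U. U \<times> {\<one>\<^bsub>C\<^esub>}) ` D.layer_one \<union> (\<lambda>U. U \<times> {c}) ` D.layer_c \<union>
    (\<lambda>U. U \<times> {inv\<^bsub>C\<^esub> c}) ` D.layer_inv_c \<union>
    (\<Union>k\<in>{2..p - 2}. (\<lambda>U. U \<times> {c [^]\<^bsub>C\<^esub> k}) ` D.layer_rest)"
    using P_rest[OF distinct_pow]
    by (simp add: layered_partition_def carrier_C P Un_assoc)
  also have "\<dots> = S"
    using c unfolding \<open>S = _\<close> \<open>G = _\<close> D8_Cp_partition_def D.layer_defs D.d_def Let_def
    by (simp add: pow_DirProd l_coset_def assms(4) D.is_group insert_commute)
  finally have S: "S = layered_partition (carrier C) P"
    by (rule HOL.sym)

  have "S_ring (H \<times>\<times> C) (partition_span (layered_partition (carrier C) P))"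
  proof (rule S_ring_layered[OF D.is_group D.finite_carrier \<open>group C\<close> finite_C partition])
    show "{\<one>\<^bsub>H\<^esub>} \<in> P \<one>\<^bsub>C\<^esub>"
      by (simp add: P D.layer_one_def D.one_eq_d)
    show "set_inv\<^bsub>H\<^esub> U \<in> P (inv\<^bsub>C\<^esub> y)" if y: "y \<in> carrier C" and U: "U \<in> P y" for y U
    proof (cases "y \<in> {\<one>\<^bsub>C\<^esub>, c, inv\<^bsub>C\<^esub> c}")
      case True
      then show ?thesis
        using U P c D.set_inv_layers by auto
    next
      case False
      then have "inv\<^bsub>C\<^esub> y \<notin> {\<one>\<^bsub>C\<^esub>, c, inv\<^bsub>C\<^esub> c}"
        using y c by (metis C.inv_inv C.inv_one insertE insertI1 insertI2 singletonD)
      then show ?thesis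
        using U P_rest False D.set_inv_layers by simp
    qed
    show "f \<otimes>\<^bsub>int_group_ring H\<^esub> g \<in> D.class_fns (P (y \<otimes>\<^bsub>C\<^esub> z))"
      if y: "y \<in> carrier C" and z: "z \<in> carrier C"
        and f: "f \<in> D.class_fns (P y)" and g: "g \<in> D.class_fns (P z)" for y z f g
    proof -
      let ?h = "f \<otimes>\<^bsub>int_group_ring H\<^esub> g"
      have rest: "?h \<in> D.class_fns (P w)" if "?h \<in> D.class_fns D.layer_rest" for w
        using that D.class_fns_rest_subset by (auto simp: P_def)
      have "y = \<one>\<^bsub>C\<^esub> \<and> f \<in> D.class_fns D.layer_one \<or> y = c \<and> f \<in> D.class_fns D.layer_c \<or>
          y = inv\<^bsub>C\<^esub> c \<and> f \<in> D.class_fns D.layer_inv_c \<or> f \<in> D.class_fns D.layer_rest"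
        using f by (simp add: P_def split: if_splits)
      moreover have "z = \<one>\<^bsub>C\<^esub> \<and> g \<in> D.class_fns D.layer_one \<or> z = c \<and> g \<in> D.class_fns D.layer_c \<or>
          z = inv\<^bsub>C\<^esub> c \<and> g \<in> D.class_fns D.layer_inv_c \<or> g \<in> D.class_fns D.layer_rest"
        using g by (simp add: P_def split: if_splits)
      ultimately show ?thesis
        by (elim disjE conjE) (simp_all add: c y z P rest D.class_fns_mult)
    qed
  qed
  moreover have "partition_on (carrier G) S"
    unfolding S \<open>G = _\<close> using partition_on_layered[of "carrier C" "carrier H" P] partition
    by (simp add: DirProd_def)
  ultimately show ?thesis
    using S \<open>G = _\<close> by simp
qed

end
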